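(* Let $P$ be a set of $n$ points in general position in the plane and let $0\le l<k\le n$ be integers. If $n\ge 2((k-l)(k-l+1)+k)$ and $l\le k/2$, then the diameter of $IJ(P,k,l)$ is $O(\log n)+O(k-l)$.
   Context: General position means no three points collinear. A subset $I\subseteq P$ is an island if $I=P\cap C$ for some convex set $C$; a $k$-island has exactly $k$ elements. $IJ(P,k,l)$ is the graph whose vertices are the $k$-islands of $P$, two adjacent if their intersection has exactly $l$ elements. The implied constants in the $O$-notation are absolute. *)

theory Defs
  imports "HOL-Analysis.Analysis" "Graph_Theory.Shortest_Path"
begin

definition general_position :: "(real^2) set \<Rightarrow> bool" where
  "general_position P \<longleftrightarrow> (\<forall>S \<subseteq> P. card S = 3 \<longrightarrow> \<not> collinear S)"

definition island :: "(real^2) set \<Rightarrow> (real^2) set \<Rightarrow> bool" where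
  "island P I \<longleftrightarrow> (\<exists>C. convex C \<and> I = P \<inter> C)"

definition islands :: "(real^2) set \<Rightarrow> nat \<Rightarrow> (real^2) set set" where
  "islands P k = {I. island P I \<and> finite I \<and> card I = k}"

text \<open>An undirected graph is represented as a symmetric digraph, as usual in this library.\<close>

definition IJ :: "(real^2) set \<Rightarrow> nat \<Rightarrow> nat \<Rightarrow>
    ((real^2) set, (real^2) set \<times> (real^2) set) pre_digraph" where
  "IJ P k l =
    \<lparr> verts = islands P k,
      arcs = {(I, J). I \<in> islands P k \<and> J \<in> islands P k \<and> card (I \<inter> J) = l},
      tail = fst, head = snd \<rparr>"

lemma graph_IJ:
  assumes "finite P" "l < k"
  shows "graph (IJ P k l)"
proof -
  have "islands P k \<subseteq> Pow P"
    by (auto simp: islands_def island_def)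
  then have fin: "finite (islands P k)"
    using assms(1) finite_subset by blast
  have "{(I, J). I \<in> islands P k \<and> J \<in> islands P k \<and> card (I \<inter> J) = l}
      \<subseteq> islands P k \<times> islands P k" by auto
  then have "finite {(I, J). I \<in> islands P k \<and> J \<in> islands P k \<and> card (I \<inter> J) = l}"
    using fin finite_subset by blast
  moreover have "symmetric (IJ P k l)"
    unfolding symmetric_conv by (force simp: IJ_def Int_commute)
  moreover have "I \<noteq> J" if "(I, J) \<in> arcs (IJ P k l)" for I J
    using that assms(2) by (auto simp: IJ_def islands_def)
  ultimately show ?thesis
    using fin by unfold_locales (auto simp: IJ_def arc_to_ends_def)
qed

text \<open>With unit arc weights, the library's infimum of walk costs is the usual graph distance;
  it is \<open>\<infinity>\<close> for vertices in different components, so a finite diameter entails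
  connectedness.\<close>

definition graph_dist :: "('a, 'b) pre_digraph \<Rightarrow> 'a \<Rightarrow> 'a \<Rightarrow> ereal" where
  "graph_dist G u v = wf_digraph.\<mu> G (\<lambda>_. 1) u v"

definition graph_diameter :: "('a, 'b) pre_digraph \<Rightarrow> ereal" where
  "graph_diameter G = (SUP u \<in> verts G. SUP v \<in> verts G. graph_dist G u v)"

end

theory Submission
  imports Defs
begin

text \<open>Put \<open>d = k - l\<close>, so \<open>l \<le> d\<close>, and order \<open>P\<close> by a linear functional \<open>h\<close> that is injective on \<open>P\<close>.
  A window is a set of \<open>h\<close>-consecutive points; it is an island.

  Every island other than \<open>P\<close> extends to an island with one more point. Given a \<open>k\<close>-island \<open>A\<close>,
  since \<open>2 l \<le> k\<close> one of two disjoint slabs contains exactly \<open>l\<close> points of \<open>A\<close> and at most half of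
  the points of \<open>P\<close> under consideration. Growing these \<open>l\<close> points inside the slab gives a neighbour
  of \<open>A\<close>; after \<open>log n\<close> halvings the slab has at most \<open>k\<close> points, so some \<open>k\<close>-window contains at
  least \<open>l\<close> points of the current island, another at most \<open>l\<close>, and sliding the window gives a
  \<open>k\<close>-window adjacent to it.

  Let \<open>L\<close> and \<open>R\<close> be the first and the last \<open>k\<close> points of an island \<open>Q\<close>. A ham-sandwich line has at
  least \<open>l\<close> points of each of \<open>L\<close> and \<open>R\<close> on both sides, so one side \<open>G\<close> has at most half of the
  points between \<open>L\<close> and \<open>R\<close>. Grow \<open>G\<close> until it has a prescribed number of these points and trim it
  by \<open>h\<close> to exactly \<open>l\<close> points of \<open>L\<close> and of \<open>R\<close>: its first and last \<open>k\<close>-windows are adjacent to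
  \<open>L\<close> and \<open>R\<close>. This halves the problem, until \<open>O(d)\<close> points remain; then the prescribed number is
  chosen in the residue class modulo \<open>d\<close> for which shifts by \<open>d\<close> lead from one window to the
  other.\<close>

subsection \<open>Growing islands\<close>

lemma island_Int_convex:
  assumes "island P I" "convex C"
  shows "island P (I \<inter> C)"
  using assms unfolding island_def by (metis convex_Int inf_assoc)

lemma island_trans:
  assumes "island P Q" "island Q I"
  shows "island P I"
  using assms island_Int_convex unfolding island_def by blast

lemma island_subset: "island P I \<Longrightarrow> I \<subseteq> P"
  by (auto simp: island_def)

lemma island_self: "island P P"
  unfolding island_def by (metis convex_UNIV inf_top_right)

lemma island_hull:
  assumes "island P I"
  shows "P \<inter> convex hull I = I"
proof -
  obtain C where C: "convex C" "I = P \<inter> C"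
    using assms by (auto simp: island_def)
  then have "convex hull I \<subseteq> C"
    by (simp add: hull_minimal)
  then show ?thesis
    using C hull_subset[of I convex] by blast
qed

text \<open>Since \<open>p\<close> lies outside the hull of \<open>I\<close>, it is an extreme point
  of the hull of \<open>insert p I\<close>. It would stay extreme in the smaller hull of
  \<open>insert q I\<close>, and extreme points of a hull belong to the generating set; this forces
  \<open>p = q\<close> or p in I.\<close>

lemma convex_hull_anti_exchange:
  fixes p q :: "'a :: euclidean_space"
  assumes "finite I" "p \<notin> convex hull I" "p \<noteq> q" "q \<in> convex hull (insert p I)"
  shows "p \<notin> convex hull (insert q I)"
proof
  assume p: "p \<in> convex hull (insert q I)"
  have "insert q I \<subseteq> convex hull (insert p I)"
    using assms(4) hull_subset[of "insert p I" convex] by auto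
  then have sub: "convex hull (insert q I) \<subseteq> convex hull (insert p I)"
    by (simp add: hull_minimal)
  have "p extreme_point_of (convex hull (insert p I))"
    using assms by (simp add: extreme_point_of_convex_hull_insert)
  then have "p extreme_point_of (convex hull (insert q I))"
    using sub p unfolding extreme_point_of_def by blast
  then have "p \<in> insert q I"
    by (rule extreme_point_of_convex_hull)
  then show False
    using assms hull_subset[of I convex] by blast
qed

text \<open>Take a \<open>p\<close> whose addition captures the fewest points of \<open>P\<close>.
  Any further captured point \<open>q\<close> would, by anti-exchange, capture a proper subset of
  these, against minimality.\<close>

lemma island_insert:
  assumes "finite P" "island P I" "I \<noteq> P"
  obtains p where "p \<in> P - I" "island P (insert p I)"
proof -
  define F where "F p = P \<inter> convex hull (insert p I)" for p
  have IP: "I \<subseteq> P" and fI: "finite I"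
    using assms island_subset finite_subset by blast+
  obtain p0 where "p0 \<in> P - I"
    using IP assms(3) by blast
  then obtain p where p: "p \<in> P - I" and min: "\<And>q. q \<in> P - I \<Longrightarrow> card (F p) \<le> card (F q)"
    using ex_has_least_nat[of "\<lambda>p. p \<in> P - I" p0 "\<lambda>p. card (F p)"] by blast
  have "F p \<subseteq> insert p I"
  proof
    fix q assume q: "q \<in> F p"
    show "q \<in> insert p I"
    proof (rule ccontr)
      assume nq: "q \<notin> insert p I"
      have "p \<notin> convex hull I"
        using island_hull[OF assms(2)] p by blast
      then have "p \<notin> F q"
        using convex_hull_anti_exchange[OF fI, of p q] q nq by (auto simp: F_def)
      moreover have "insert q I \<subseteq> convex hull (insert p I)"
        using q hull_subset[of "insert p I" convex] by (auto simp: F_def)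
      then have "F q \<subseteq> F p"
        unfolding F_def
        using hull_minimal[of "insert q I" "convex hull (insert p I)" convex] by auto
      moreover have "p \<in> F p"
        using p by (simp add: F_def hull_inc)
      ultimately have "F q \<subset> F p"
        by blast
      then have "card (F q) < card (F p)"
        using assms(1) by (simp add: F_def psubset_card_mono)
      then show False
        using min[of q] q nq by (auto simp: F_def)
    qed
  qed
  moreover have "insert p I \<subseteq> F p"
    using p IP by (auto simp: F_def hull_inc)
  ultimately have "insert p I = P \<inter> convex hull (insert p I)"
    by (auto simp: F_def)
  then have "island P (insert p I)"
    unfolding island_def using convex_convex_hull by blast
  with p that show ?thesis
    by blast
qed

text \<open>Each insertion raises the count in \<open>M\<close> by at most one, and growth can stop
  only at \<open>P\<close>, where the count is \<open>card M\<close>; so the value \<open>m\<close>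
  is not skipped.\<close>

lemma island_grow:
  assumes "finite P" "island P I" "M \<subseteq> P" "card (I \<inter> M) \<le> m" "m \<le> card M"
  shows "\<exists>J. island P J \<and> I \<subseteq> J \<and> card (J \<inter> M) = m"
  using assms(2,4)
proof (induction "card (P - I)" arbitrary: I rule: less_induct)
  case less
  show ?case
  proof (cases "card (I \<inter> M) = m")
    case True
    then show ?thesis
      using less.prems by blast
  next
    case False
    have fM: "finite M"
      using assms(1,3) finite_subset by blast
    have "I \<noteq> P"
      using False less.prems assms(3,5) by (auto simp: Int_absorb1)
    then obtain p where p: "p \<in> P - I" "island P (insert p I)"
      using island_insert assms(1) less.prems by blast
    have "card (P - insert p I) < card (P - I)"
      using p assms(1) by (intro psubset_card_mono) auto
    moreover have "card (insert p I \<inter> M) \<le> m"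
    proof -
      have "insert p I \<inter> M \<subseteq> insert p (I \<inter> M)" by blast
      then have "card (insert p I \<inter> M) \<le> Suc (card (I \<inter> M))"
        using card_mono[of "insert p (I \<inter> M)" "insert p I \<inter> M"] fM p(1)
        by (simp add: card_insert_if)
      then show ?thesis
        using False less.prems by linarith
    qed
    ultimately show ?thesis
      using less.hyps[of "insert p I"] p by blast
  qed
qed

section \<open>Discrete intermediate values, and finite maxima and minima of continuous
  functions\<close>

lemma nat_intermediate_value:
  fixes f :: "nat \<Rightarrow> nat"
  assumes "a \<le> b" "f a \<le> v" "v \<le> f b" "\<And>i. a \<le> i \<Longrightarrow> i < b \<Longrightarrow> f (Suc i) \<le> Suc (f i)"
  shows "\<exists>i. a \<le> i \<and> i \<le> b \<and> f i = v"
  using assms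
proof (induction b rule: dec_induct)
  case base
  then show ?case by auto
next
  case (step n)
  show ?case
  proof (cases "v \<le> f n")
    case True
    then show ?thesis using step by force
  next
    case False
    then have "f (Suc n) = v"
      using step.prems(2) step.prems(3)[of n] step.hyps by simp
    then show ?thesis using step.hyps by (intro exI[of _ "Suc n"]) auto
  qed
qed

lemma continuous_on_Max:
  fixes f :: "'i \<Rightarrow> 'a :: topological_space \<Rightarrow> real"
  assumes "finite I" "I \<noteq> {}" "\<And>i. i \<in> I \<Longrightarrow> continuous_on S (f i)"
  shows "continuous_on S (\<lambda>x. Max ((\<lambda>i. f i x) ` I))"
  using assms
  by (induction I rule: finite_ne_induct) (auto intro!: continuous_on_max)

lemma continuous_on_Min:
  fixes f :: "'i \<Rightarrow> 'a :: topological_space \<Rightarrow> real"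
  assumes "finite I" "I \<noteq> {}" "\<And>i. i \<in> I \<Longrightarrow> continuous_on S (f i)"
  shows "continuous_on S (\<lambda>x. Min ((\<lambda>i. f i x) ` I))"
  using assms
  by (induction I rule: finite_ne_induct) (auto intro!: continuous_on_min)

subsection \<open>Order statistics and ham-sandwich cuts\<close>

text \<open>The max-min form over subsets of size \<open>l\<close> avoids sorting and tie-breaking,
  and continuity in the values of \<open>f\<close> follows at once.\<close>

definition kth_largest :: "nat \<Rightarrow> ('a \<Rightarrow> real) \<Rightarrow> 'a set \<Rightarrow> real" where
  "kth_largest l f A = Max ((\<lambda>X. Min (f ` X)) ` {X. X \<subseteq> A \<and> card X = l})"

text \<open>A subset attaining the maximum lies weakly above the threshold, while \<open>l\<close>
  points strictly above it would form a subset with a larger minimum. The weak count serves one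
  closed side of a cut, the strict count the other.\<close>

lemma kth_largest_props:
  assumes "finite A" "1 \<le> l" "l \<le> card A"
  shows "l \<le> card {x \<in> A. kth_largest l f A \<le> f x}"
    and "card {x \<in> A. kth_largest l f A < f x} < l"
    and "\<exists>x\<in>A. f x = kth_largest l f A"
proof -
  let ?F = "{X. X \<subseteq> A \<and> card X = l}"
  have fin: "finite ?F"
    using assms(1) by simp
  have ne: "?F \<noteq> {}"
    using obtain_subset_with_card_n[OF assms(3)] by blast
  have "kth_largest l f A \<in> (\<lambda>X. Min (f ` X)) ` ?F"
    unfolding kth_largest_def using fin ne by (intro Max_in) auto
  then obtain X where X: "X \<subseteq> A" "card X = l" "kth_largest l f A = Min (f ` X)"
    by blast
  have fX: "finite X" "X \<noteq> {}"
    using X assms finite_subset by auto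
  have "X \<subseteq> {x \<in> A. kth_largest l f A \<le> f x}"
    using X fX by auto
  then show "l \<le> card {x \<in> A. kth_largest l f A \<le> f x}"
    using X(2) assms(1) card_mono[of "{x \<in> A. kth_largest l f A \<le> f x}" X] by simp
  have "Min (f ` X) \<in> f ` X"
    using fX by simp
  then show "\<exists>x\<in>A. f x = kth_largest l f A"
    using X by auto
  show "card {x \<in> A. kth_largest l f A < f x} < l"
  proof (rule ccontr)
    assume "\<not> ?thesis"
    then obtain Y where Y: "Y \<subseteq> {x \<in> A. kth_largest l f A < f x}" "card Y = l"
      using obtain_subset_with_card_n[of l "{x \<in> A. kth_largest l f A < f x}"] by auto
    then have "Y \<in> ?F" "finite Y" "Y \<noteq> {}"
      using assms finite_subset[of Y A] by auto
    then have "Min (f ` Y) \<le> kth_largest l f A"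
      unfolding kth_largest_def using fin by (intro Max_ge) auto
    moreover have "Min (f ` Y) \<in> f ` Y"
      using \<open>finite Y\<close> \<open>Y \<noteq> {}\<close> by simp
    ultimately show False
      using Y by auto
  qed
qed

lemma continuous_on_kth_largest:
  fixes f :: "real \<Rightarrow> 'a \<Rightarrow> real"
  assumes "finite A" "1 \<le> l" "l \<le> card A" "\<And>x. x \<in> A \<Longrightarrow> continuous_on S (\<lambda>s. f s x)"
  shows "continuous_on S (\<lambda>s. kth_largest l (f s) A)"
  unfolding kth_largest_def
proof (rule continuous_on_Max)
  show "finite {X. X \<subseteq> A \<and> card X = l}"
    using assms(1) by simp
  show "{X. X \<subseteq> A \<and> card X = l} \<noteq> {}"
    using obtain_subset_with_card_n[OF assms(3)] by blast
  fix X assume "X \<in> {X. X \<subseteq> A \<and> card X = l}"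
  then show "continuous_on S (\<lambda>s. Min (f s ` X))"
    using assms finite_subset by (intro continuous_on_Min) auto
qed

text \<open>A discrete ham-sandwich cut, by the intermediate value theorem in the slope \<open>s\<close>.\<close>

lemma exists_common_kth_largest:
  fixes h w :: "'a \<Rightarrow> real"
  assumes "finite A" "finite B" "1 \<le> l" "l \<le> card A" "l \<le> card B"
    and sep: "\<And>a b. a \<in> A \<Longrightarrow> b \<in> B \<Longrightarrow> h a < h b"
  obtains s where "kth_largest l (\<lambda>v. w v - s * h v) A = kth_largest l (\<lambda>v. w v - s * h v) B"
proof -
  define g where "g X s = kth_largest l (\<lambda>v. w v - s * h v) X" for X s
  \<comment> \<open>\<open>K\<close> is the largest absolute slope between a point of
    \<open>A\<close> and a point of \<open>B\<close> in the coordinates (h, w). At s = K all values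
    on \<open>A\<close> are at least those on \<open>B\<close>; at s = -K the order is
    reversed.\<close>
  define K where "K = Max ((\<lambda>(a, b). \<bar>w a - w b\<bar> / (h b - h a)) ` (A \<times> B))"
  have AB: "A \<noteq> {}" "B \<noteq> {}"
    using assms by auto
  have K: "\<bar>w a - w b\<bar> \<le> K * (h b - h a)" if "a \<in> A" "b \<in> B" for a b
  proof -
    have "\<bar>w a - w b\<bar> / (h b - h a) \<le> K"
      unfolding K_def using that assms by (intro Max_ge) auto
    then show ?thesis
      using sep[OF that] by (simp add: pos_divide_le_eq)
  qed
  obtain a b where ab: "a \<in> A" "b \<in> B"
    using AB by blast
  have "0 \<le> K * (h b - h a)"
    using K[OF ab] by linarith
  then have K0: "0 \<le> K"
    using sep[OF ab] by (simp add: zero_le_mult_iff)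
  have att: "\<exists>x\<in>X. w x - s * h x = g X s" if "X = A \<or> X = B" for X s
    using kth_largest_props(3)[of X l "\<lambda>v. w v - s * h v"] that assms by (auto simp: g_def)
  have up: "g B K \<le> g A K"
  proof -
    obtain x where "x \<in> A" "w x - K * h x = g A K"
      using att[of A K] by blast
    moreover obtain y where "y \<in> B" "w y - K * h y = g B K"
      using att[of B K] by blast
    ultimately show ?thesis
      using K[of x y] by (auto simp: algebra_simps)
  qed
  have down: "g A (-K) \<le> g B (-K)"
  proof -
    obtain x where "x \<in> A" "w x - (-K) * h x = g A (-K)"
      using att[of A "-K"] by blast
    moreover obtain y where "y \<in> B" "w y - (-K) * h y = g B (-K)"
      using att[of B "-K"] by blast
    ultimately show ?thesis
      using K[of x y] by (auto simp: algebra_simps)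
  qed
  have "continuous_on {-K..K} (\<lambda>s. g A s - g B s)"
    unfolding g_def using assms
    by (intro continuous_on_diff continuous_on_kth_largest continuous_intros) auto
  then obtain s where "g A s - g B s = 0"
    using IVT'[of "\<lambda>s. g A s - g B s" "-K" 0 K] up down K0 by auto
  then show ?thesis
    using that by (simp add: g_def)
qed

subsection \<open>Windows of a linear order\<close>

definition rank_of :: "('a \<Rightarrow> real) \<Rightarrow> 'a set \<Rightarrow> 'a \<Rightarrow> nat" where
  "rank_of h Q x = card {y \<in> Q. h y < h x}"

text \<open>With positions given by ranks, intersections of windows of the same set become interval
  arithmetic. A window running past the end of \<open>Q\<close> is cut short.\<close>

definition window :: "('a \<Rightarrow> real) \<Rightarrow> 'a set \<Rightarrow> nat \<Rightarrow> nat \<Rightarrow> 'a set" where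
  "window h Q a b = {x \<in> Q. a \<le> rank_of h Q x \<and> rank_of h Q x < a + b}"

lemma window_subset: "window h Q a b \<subseteq> Q"
  by (auto simp: window_def)

lemma finite_window: "finite Q \<Longrightarrow> finite (window h Q a b)"
  by (simp add: window_def)

lemma window_0: "window h Q a 0 = {}"
  by (auto simp: window_def)

lemma window_mono: "c \<le> a \<Longrightarrow> a + b \<le> c + e \<Longrightarrow> window h Q a b \<subseteq> window h Q c e"
  by (auto simp: window_def)

lemma rank_of_less_iff:
  assumes "finite Q" "x \<in> Q" "y \<in> Q"
  shows "rank_of h Q x < rank_of h Q y \<longleftrightarrow> h x < h y"
proof
  assume "h x < h y"
  then have "{z \<in> Q. h z < h x} \<subset> {z \<in> Q. h z < h y}"
    using assms by force
  then show "rank_of h Q x < rank_of h Q y"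
    unfolding rank_of_def using assms(1) by (intro psubset_card_mono) auto
next
  assume *: "rank_of h Q x < rank_of h Q y"
  show "h x < h y"
  proof (rule ccontr)
    assume "\<not> ?thesis"
    then have "{z \<in> Q. h z < h y} \<subseteq> {z \<in> Q. h z < h x}"
      by auto
    then have "rank_of h Q y \<le> rank_of h Q x"
      unfolding rank_of_def using assms(1) by (intro card_mono) auto
    then show False
      using * by simp
  qed
qed

lemma bij_betw_rank_of:
  assumes "finite Q" "inj_on h Q"
  shows "bij_betw (rank_of h Q) Q {..<card Q}"
proof -
  have inj: "inj_on (rank_of h Q) Q"
  proof (rule inj_onI)
    fix x y assume xy: "x \<in> Q" "y \<in> Q" "rank_of h Q x = rank_of h Q y"
    then have "\<not> h x < h y" "\<not> h y < h x"
      using rank_of_less_iff[OF assms(1), of x y h] rank_of_less_iff[OF assms(1), of y x h] by auto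
    then show "x = y"
      using xy assms(2) by (auto simp: inj_on_def)
  qed
  have "rank_of h Q ` Q \<subseteq> {..<card Q}"
    unfolding rank_of_def using assms(1) by (auto intro!: psubset_card_mono)
  then have "rank_of h Q ` Q = {..<card Q}"
    by (intro card_subset_eq) (auto simp: card_image inj)
  then show ?thesis
    using inj by (simp add: bij_betw_def)
qed

lemma card_rank_of_in:
  assumes "finite Q" "inj_on h Q" "S \<subseteq> {..<card Q}"
  shows "card {x \<in> Q. rank_of h Q x \<in> S} = card S"
proof (rule bij_betw_same_card)
  have "rank_of h Q ` Q = {..<card Q}" "inj_on (rank_of h Q) Q"
    using bij_betw_rank_of[OF assms(1,2)] by (simp_all add: bij_betw_def)
  then show "bij_betw (rank_of h Q) {x \<in> Q. rank_of h Q x \<in> S} S"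
    using assms(3) by (intro bij_betw_imageI) (auto simp: inj_on_def)
qed

lemma card_window:
  assumes "finite Q" "inj_on h Q" "a + b \<le> card Q"
  shows "card (window h Q a b) = b"
proof -
  have "window h Q a b = {x \<in> Q. rank_of h Q x \<in> {a..<a + b}}"
    by (auto simp: window_def)
  then show ?thesis
    using card_rank_of_in[OF assms(1,2), of "{a..<a + b}"] assms(3)
    by (simp add: ivl_subset lessThan_atLeast0)
qed

lemma window_Int_window:
  "window h Q a b \<inter> window h Q c e = window h Q (max a c) (min (a + b) (c + e) - max a c)"
  by (auto simp: window_def)

lemma window_all:
  assumes "finite Q" "inj_on h Q"
  shows "window h Q 0 (card Q) = Q"
  using bij_betw_rank_of[OF assms] by (auto simp: window_def bij_betw_def)

lemma rank_of_window:
  assumes "finite Q" "inj_on h Q" "x \<in> window h Q a b"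
  shows "rank_of h (window h Q a b) x = rank_of h Q x - a"
proof -
  have x: "x \<in> Q" "a \<le> rank_of h Q x" "rank_of h Q x < a + b"
    using assms(3) by (auto simp: window_def)
  have "rank_of h Q x < card Q"
    using x(1) bij_betw_rank_of[OF assms(1,2)] by (auto simp: bij_betw_def)
  moreover have "{y \<in> window h Q a b. h y < h x} = {y \<in> Q. rank_of h Q y \<in> {a..<rank_of h Q x}}"
    using x rank_of_less_iff[OF assms(1), of _ x h] by (force simp: window_def)
  ultimately show ?thesis
    using card_rank_of_in[OF assms(1,2), of "{a..<rank_of h Q x}"]
    by (simp add: rank_of_def[of h "window h Q a b"] lessThan_atLeast0)
qed

lemma window_window:
  assumes "finite Q" "inj_on h Q" "c + e \<le> b"
  shows "window h (window h Q a b) c e = window h Q (a + c) e"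
proof -
  have "x \<in> window h (window h Q a b) c e \<longleftrightarrow> x \<in> window h Q (a + c) e" for x
  proof (cases "x \<in> window h Q a b")
    case True
    then show ?thesis
      using rank_of_window[OF assms(1,2) True] assms(3)
      by (auto simp: window_def[of h "window h Q a b"]) (auto simp: window_def)
  next
    case False
    then show ?thesis
      using assms(3) window_subset[of h "window h Q a b"] by (auto simp: window_def)
  qed
  then show ?thesis by blast
qed

lemma rank_of_less_card:
  assumes "finite Q" "inj_on h Q" "x \<in> Q"
  shows "rank_of h Q x < card Q"
  using bij_betw_rank_of[OF assms(1,2)] assms(3) by (auto simp: bij_betw_def)

lemma initial_segment_eq_window:
  assumes "finite Q" "inj_on h Q" "S \<subseteq> Q" "\<And>x y. x \<in> S \<Longrightarrow> y \<in> Q - S \<Longrightarrow> h x < h y"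
  shows "S = window h Q 0 (card S)"
proof (rule card_subset_eq)
  have S: "finite S" "card S \<le> card Q"
    using assms(1,3) finite_subset[of S Q] card_mono[of Q S] by auto
  show "finite (window h Q 0 (card S))"
    using assms(1) by (rule finite_window)
  show "card S = card (window h Q 0 (card S))"
    using card_window[OF assms(1,2)] S by simp
  show "S \<subseteq> window h Q 0 (card S)"
  proof
    fix x assume x: "x \<in> S"
    have "y \<in> S" if "y \<in> Q" "h y < h x" for y
      using assms(4)[OF x, of y] that by force
    then have "{y \<in> Q. h y < h x} \<subset> S"
      using x by auto
    then have "rank_of h Q x < card S"
      unfolding rank_of_def using S by (intro psubset_card_mono)
    then show "x \<in> window h Q 0 (card S)"
      using x assms(3) by (auto simp: window_def)
  qed
qed

lemma final_segment_eq_window: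
  assumes "finite Q" "inj_on h Q" "S \<subseteq> Q" "\<And>x y. x \<in> S \<Longrightarrow> y \<in> Q - S \<Longrightarrow> h y < h x"
  shows "S = window h Q (card Q - card S) (card S)"
proof -
  have S: "finite S" "card S \<le> card Q"
    using assms(1,3) finite_subset[of S Q] card_mono[of Q S] by auto
  have c: "card (Q - S) = card Q - card S"
    using card_Diff_subset[OF S(1) assms(3)] .
  have "Q - S = window h Q 0 (card (Q - S))"
    using assms by (intro initial_segment_eq_window) auto
  moreover have "Q - window h Q 0 (card (Q - S)) = window h Q (card Q - card S) (card S)"
    using rank_of_less_card[OF assms(1,2)] S c by (auto simp: window_def)
  ultimately show ?thesis
    using assms(3) by blast
qed

lemma window_add:
  assumes "finite Q" "inj_on h Q"
  shows "card (A \<inter> window h Q a (b + c)) = card (A \<inter> window h Q a b) + card (A \<inter> window h Q (a + b) c)"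
proof -
  have "A \<inter> window h Q a (b + c) = (A \<inter> window h Q a b) \<union> (A \<inter> window h Q (a + b) c)"
    by (auto simp: window_def)
  moreover have "finite (window h Q a b)" "finite (window h Q (a + b) c)" for a b c
    using assms(1) by (auto intro: finite_window)
  moreover have "(A \<inter> window h Q a b) \<inter> (A \<inter> window h Q (a + b) c) = {}"
    by (auto simp: window_def)
  ultimately show ?thesis
    by (simp add: card_Un_disjoint)
qed

lemma card_Int_window_1:
  assumes "finite Q" "inj_on h Q"
  shows "card (A \<inter> window h Q a 1) \<le> 1"
proof (cases "a + 1 \<le> card Q")
  case True
  then show ?thesis
    using card_window[OF assms True] finite_window[OF assms(1)]
      card_mono[of "window h Q a 1" "A \<inter> window h Q a 1"] by simp
next
  case False
  then have "window h Q a 1 = {}"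
    using rank_of_less_card[OF assms] by (force simp: window_def)
  then show ?thesis by simp
qed

lemma island_window:
  assumes "linear h" "finite Q"
  shows "island Q (window h Q a b)"
proof -
  let ?W = "window h Q a b"
  \<comment> \<open>Quantifying over both end points describes the interval spanned by the values of
    \<open>h\<close> and also covers an empty window.\<close>
  define C where "C = h -` {t. \<exists>x\<in>?W. \<exists>z\<in>?W. h x \<le> t \<and> t \<le> h z}"
  have "is_interval {t. \<exists>x\<in>?W. \<exists>z\<in>?W. h x \<le> t \<and> t \<le> h z}"
    unfolding is_interval_1 using order_trans by (simp, blast)
  then have "convex C"
    unfolding C_def using assms(1) by (intro convex_linear_vimage) (auto simp: is_interval_convex_1)
  moreover have "?W = Q \<inter> C"
  proof -
    have "y \<in> ?W" if "y \<in> Q" "x \<in> ?W" "z \<in> ?W" "h x \<le> h y" "h y \<le> h z" for x y z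
    proof -
      have "rank_of h Q x \<le> rank_of h Q y" "rank_of h Q y \<le> rank_of h Q z"
        unfolding rank_of_def using that assms(2) by (auto intro!: card_mono)
      then show ?thesis
        using that by (auto simp: window_def)
    qed
    then show ?thesis
      using window_subset[of h Q a b] by (auto simp: C_def)
  qed
  ultimately show ?thesis
    unfolding island_def by blast
qed

subsection \<open>The adjacency graph of islands\<close>

text \<open>\<open>h\<close> orders the windows, and the functionals w - s h supply the cuts. By
  \<open>lines\<close> each cut is a line, so general position allows at most two points of
  \<open>P\<close> on it.\<close>

locale island_graph =
  fixes P :: "(real^2) set" and k l :: nat and h w :: "real^2 \<Rightarrow> real"
  assumes fin: "finite P" and gp: "general_position P"
    and lin_h: "linear h" and lin_w: "linear w" and inj: "inj_on h P"
    and lines: "\<And>s t. collinear {v. w v - s * h v = t}"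
    and l_less_k: "l < k" and two_l_le_k: "2 * l \<le> k"
begin

abbreviation d :: nat where "d \<equiv> k - l"

definition adj :: "((real^2) set \<times> (real^2) set) set" where
  "adj = {(I, J). I \<in> islands P k \<and> J \<in> islands P k \<and> card (I \<inter> J) = l}"

text \<open>Distance bounds are kept as powers of a relation; walks enter only in
  \<open>graph_dist_le_relpow\<close>.\<close>

definition reach :: "nat \<Rightarrow> (real^2) set \<Rightarrow> (real^2) set \<Rightarrow> bool" where
  "reach m I J \<longleftrightarrow> (\<exists>i\<le>m. (I, J) \<in> adj ^^ i)"

lemma reach_refl: "reach m I I"
  unfolding reach_def by (intro exI[of _ 0]) simp

lemma reach_mono: "reach m I J \<Longrightarrow> m \<le> m' \<Longrightarrow> reach m' I J"
  unfolding reach_def using order_trans by blast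

lemma reach_trans:
  assumes "reach a I J" "reach b J K"
  shows "reach (a + b) I K"
proof -
  obtain i j where "i \<le> a" "(I, J) \<in> adj ^^ i" "j \<le> b" "(J, K) \<in> adj ^^ j"
    using assms unfolding reach_def by blast
  then have "i + j \<le> a + b" "(I, K) \<in> adj ^^ (i + j)"
    by (auto simp: relpow_add)
  then show ?thesis
    unfolding reach_def by blast
qed

lemma reach_adj: "(I, J) \<in> adj \<Longrightarrow> reach 1 I J"
  unfolding reach_def by (intro exI[of _ 1]) simp

lemma reach_sym:
  assumes "reach m I J"
  shows "reach m J I"
proof -
  have "adj\<inverse> = adj"
    by (auto simp: adj_def Int_commute)
  then have "(J, I) \<in> adj ^^ i" if "(I, J) \<in> adj ^^ i" for i
    using that
  proof (induction i arbitrary: J)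
    case (Suc i)
    then obtain K where "(I, K) \<in> adj ^^ i" "(K, J) \<in> adj"
      by auto
    then have "(K, I) \<in> adj ^^ i" "(J, K) \<in> adj"
      using Suc by auto
    then show ?case
      by (metis relpow_Suc_I2)
  qed simp
  then show ?thesis
    using assms unfolding reach_def by blast
qed

section \<open>Windows of islands, and paths between the first and the last window\<close>

lemma islandD:
  assumes "island P Q"
  shows "finite Q" "inj_on h Q" "Q \<subseteq> P"
  using island_subset[OF assms] fin inj finite_subset inj_on_subset by blast+

lemma island_of_window: "island P Q \<Longrightarrow> island P (window h Q a b)"
  using island_trans island_window[OF lin_h islandD(1)] by blast

lemma window_in_islands:
  assumes "island P Q" "a + k \<le> card Q"
  shows "window h Q a k \<in> islands P k"
  using island_of_window[OF assms(1)] card_window[OF islandD(1,2)[OF assms(1)] assms(2)]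
    finite_window[OF islandD(1)[OF assms(1)]]
  by (simp add: islands_def)

text \<open>Choose the cut so that \<open>L\<close> and \<open>R\<close> have the same l-th largest
  value \<open>t\<close>. The upper closed side has at least \<open>l\<close> points of each; fewer
  than \<open>l\<close> lie strictly above, so the lower closed side has at least \<open>l\<close>
  too. The cut passes through a point of \<open>L\<close> and one of \<open>R\<close>, hence misses
  all other points of \<open>Q\<close>, which are thus split between the two sides.\<close>

lemma halving_island:
  assumes "Q \<subseteq> P" "L \<subseteq> Q" "R \<subseteq> Q" "2 * l \<le> card L" "2 * l \<le> card R"
    and sep: "\<And>a b. a \<in> L \<Longrightarrow> b \<in> R \<Longrightarrow> h a < h b"
  obtains G where "island Q G" "l \<le> card (G \<inter> L)" "l \<le> card (G \<inter> R)"
    "2 * card (G \<inter> (Q - L - R)) \<le> card (Q - L - R)"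
proof (cases "l = 0")
  case True
  have "island Q {}"
    unfolding island_def by (rule exI[of _ "{}"]) simp
  then show ?thesis
    using that[of "{}"] True by simp
next
  case False
  define M where "M = Q - L - R"
  have finQ: "finite Q" "finite L" "finite R" "finite M"
    using assms(1-3) fin unfolding M_def by (auto dest: finite_subset)
  obtain s where s: "kth_largest l (\<lambda>v. w v - s * h v) L = kth_largest l (\<lambda>v. w v - s * h v) R"
    using exists_common_kth_largest[OF finQ(2,3), of l h w] False assms(4,5) sep by auto
  define f where "f v = w v - s * h v" for v
  define t where "t = kth_largest l f L"
  have tR: "t = kth_largest l f R"
    using s unfolding t_def f_def[abs_def] .
  have propL: "l \<le> card {x \<in> L. t \<le> f x}" "card {x \<in> L. t < f x} < l" "\<exists>x\<in>L. f x = t"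
    using kth_largest_props[OF finQ(2), of l f] False assms(4) by (auto simp: t_def)
  have propR: "l \<le> card {x \<in> R. t \<le> f x}" "card {x \<in> R. t < f x} < l" "\<exists>x\<in>R. f x = t"
    using kth_largest_props[OF finQ(3), of l f] False assms(5) by (auto simp: tR)
  have "linear f"
    unfolding f_def[abs_def] using lin_w lin_h
    by (intro linear_compose_sub) (auto simp: linear_iff algebra_simps)
  then have conv: "convex (f -` {t..})" "convex (f -` {..t})"
    by (auto intro!: convex_linear_vimage)
  have line: "f p \<noteq> t" if "p \<in> M" for p
  proof
    assume p: "f p = t"
    obtain a b where ab: "a \<in> L" "f a = t" "b \<in> R" "f b = t"
      using propL(3) propR(3) by blast
    have "a \<noteq> b" "a \<noteq> p" "b \<noteq> p"
      using ab that sep[of a b] by (auto simp: M_def)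
    then have "card {a, b, p} = 3"
      by simp
    moreover have "{a, b, p} \<subseteq> P"
      using ab that assms(1-3) by (auto simp: M_def)
    moreover have "collinear {a, b, p}"
      by (rule collinear_subset[OF lines[of s t]]) (use ab p in \<open>auto simp: f_def\<close>)
    ultimately show False
      using gp unfolding general_position_def by blast
  qed
  have "M = (M \<inter> f -` {t..}) \<union> (M \<inter> f -` {..t})" "(M \<inter> f -` {t..}) \<inter> (M \<inter> f -` {..t}) = {}"
    using line by (auto intro: antisym)
  then have cM: "card M = card (M \<inter> f -` {t..}) + card (M \<inter> f -` {..t})"
    using finQ(4) card_Un_disjoint by (metis finite_Int)
  have below: "l \<le> card (X \<inter> f -` {..t})"
    if "finite X" "2 * l \<le> card X" "card {x \<in> X. t < f x} < l" for X
  proof -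
    have "X = {x \<in> X. t < f x} \<union> (X \<inter> f -` {..t})" "{x \<in> X. t < f x} \<inter> (X \<inter> f -` {..t}) = {}"
      by auto
    then have "card X = card {x \<in> X. t < f x} + card (X \<inter> f -` {..t})"
      using that(1) by (metis (no_types, lifting) card_Un_disjoint finite_Un)
    then show ?thesis
      using that by linarith
  qed
  have above: "X \<inter> f -` {t..} = {x \<in> X. t \<le> f x}" for X
    by auto
  show ?thesis
  proof (cases "2 * card (M \<inter> f -` {t..}) \<le> card M")
    case True
    have "Q \<inter> f -` {t..} \<inter> X = X \<inter> f -` {t..}" if "X \<subseteq> Q" for X
      using that by blast
    moreover have "island Q (Q \<inter> f -` {t..})"
      using conv unfolding island_def by blast
    ultimately show ?thesis
      using that[of "Q \<inter> f -` {t..}"] True propL(1) propR(1) above[of L] above[of R] assms(2,3)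
      by (simp add: M_def Diff_subset subset_trans[OF Diff_subset])
  next
    case False
    have "Q \<inter> f -` {..t} \<inter> X = X \<inter> f -` {..t}" if "X \<subseteq> Q" for X
      using that by blast
    moreover have "island Q (Q \<inter> f -` {..t})"
      using conv unfolding island_def by blast
    moreover have "M \<subseteq> Q" "2 * card (M \<inter> f -` {..t}) \<le> card M"
      using False cM by (auto simp: M_def)
    ultimately show ?thesis
      using that[of "Q \<inter> f -` {..t}"] below[OF finQ(2)] below[OF finQ(3)] propL propR assms(2-5)
      by (simp add: M_def)
  qed
qed

text \<open>Windows of length \<open>k\<close> shifted by \<open>d\<close> overlap in k - d = l
  points.\<close>

lemma reach_shift:
  assumes "island P Q" "a + t * d + k \<le> card Q"
  shows "reach t (window h Q a k) (window h Q (a + t * d) k)"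
  using assms(2)
proof (induction t)
  case 0
  then show ?case by (simp add: reach_refl)
next
  case (Suc t)
  have 1: "reach t (window h Q a k) (window h Q (a + t * d) k)"
    using Suc by simp
  have "window h Q (a + t * d) k \<inter> window h Q (a + Suc t * d) k = window h Q (a + Suc t * d) l"
    using l_less_k by (simp add: window_Int_window)
  then have "(window h Q (a + t * d) k, window h Q (a + Suc t * d) k) \<in> adj"
    using Suc.prems assms(1) l_less_k islandD[OF assms(1)]
    by (auto simp: adj_def intro!: window_in_islands card_window)
  then show ?case
    using reach_trans[OF 1 reach_adj] by simp
qed

text \<open>\<open>m\<close> is the prescribed number of points of \<open>G\<close> between the two
  end windows. Trimming \<open>G\<close> to \<open>l\<close> points of each end window leaves m + 2
  l consecutive points from rank \<open>c\<close> on; the last \<open>k\<close> of them start at c +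
  m + 2 l - k = c + m + l - d. The condition \<open>d \<le> m + l\<close> says that \<open>k\<close>
  points fit.\<close>

lemma halving_cut:
  assumes Q: "island P Q" and N: "card Q = 2 * k + N"
  obtains m0 where "2 * m0 \<le> N"
    "\<And>m. m0 \<le> m \<Longrightarrow> d \<le> m + l \<Longrightarrow> m \<le> N \<Longrightarrow> \<exists>G c. island P G \<and> c + m + 2 * l \<le> card G \<and>
      (window h Q 0 k, window h G c k) \<in> adj \<and> (window h G (c + m + l - d) k, window h Q (k + N) k) \<in> adj"
proof -
  define L where "L = window h Q 0 k"
  define R where "R = window h Q (k + N) k"
  define M where "M = Q - L - R"
  note Qf = islandD[OF Q]
  have LR: "L \<in> islands P k" "R \<in> islands P k"
    unfolding L_def R_def using window_in_islands[OF Q] N by auto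
  then have cLR: "card L = k" "card R = k" "finite L" "finite R"
    by (auto simp: islands_def)
  have sub: "L \<subseteq> Q" "R \<subseteq> Q" "M \<subseteq> Q"
    by (auto simp: L_def R_def M_def window_def)
  have LR_disj: "L \<inter> R = {}"
    by (auto simp: L_def R_def window_def)
  have cM: "card M = N"
  proof -
    have "R \<subseteq> Q - L"
      using sub LR_disj by blast
    then show ?thesis
      unfolding M_def using N cLR sub by (simp add: card_Diff_subset)
  qed
  have L_low: "h x < h y" if "x \<in> L" "y \<in> Q - L" for x y
    using that rank_of_less_iff[OF Qf(1), of x y h] by (auto simp: L_def window_def)
  have R_high: "h y < h x" if "x \<in> R" "y \<in> Q - R" for x y
    using that rank_of_less_iff[OF Qf(1), of y x h] rank_of_less_card[OF Qf(1,2)] N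
    by (force simp: R_def window_def)
  obtain G0 where G0: "island Q G0" "l \<le> card (G0 \<inter> L)" "l \<le> card (G0 \<inter> R)" "2 * card (G0 \<inter> M) \<le> card M"
  proof (rule halving_island[OF Qf(3) sub(1,2)])
    show "2 * l \<le> card L" "2 * l \<le> card R"
      using cLR two_l_le_k by auto
    show "h a < h b" if "a \<in> L" "b \<in> R" for a b
      using that L_low[of a b] LR_disj sub by blast
  qed (auto simp: M_def)
  show ?thesis
  proof (rule that)
    show "2 * card (G0 \<inter> M) \<le> N"
      using G0 cM by simp
    fix m assume m: "card (G0 \<inter> M) \<le> m" "d \<le> m + l" "m \<le> N"
    obtain G where G: "island Q G" "G0 \<subseteq> G" "card (G \<inter> M) = m"
      using island_grow[OF Qf(1) G0(1) sub(3) m(1)] m(3) cM by blast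
    define i where "i = card (G \<inter> L)"
    define j where "j = card (G \<inter> R)"
    have PG: "island P G"
      using island_trans Q G by blast
    note Gf = islandD[OF PG]
    have ij: "l \<le> i" "l \<le> j"
      unfolding i_def j_def
      using G0(2,3) G(2) Gf(1) by (meson Int_mono card_mono finite_Int order_refl order_trans)+
    have GQ: "G \<subseteq> Q"
      using island_subset G by blast
    have cG: "card G = i + m + j"
    proof -
      have "G = (G \<inter> L) \<union> ((G \<inter> M) \<union> (G \<inter> R))"
        using GQ by (auto simp: M_def)
      moreover have "card ((G \<inter> M) \<union> (G \<inter> R)) = m + j"
        unfolding j_def G(3)[symmetric] using Gf(1) by (intro card_Un_disjoint) (auto simp: M_def)
      moreover have "card ((G \<inter> L) \<union> ((G \<inter> M) \<union> (G \<inter> R))) = i + card ((G \<inter> M) \<union> (G \<inter> R))"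
        unfolding i_def using Gf(1) LR_disj by (intro card_Un_disjoint) (auto simp: M_def)
      ultimately show ?thesis by simp
    qed
    have GL: "G \<inter> L = window h G 0 i"
      unfolding i_def using L_low GQ Gf by (intro initial_segment_eq_window) auto
    have "G \<inter> R = window h G (card G - j) j"
      unfolding j_def using R_high GQ Gf by (intro final_segment_eq_window) auto
    then have GR: "G \<inter> R = window h G (i + m) j"
      using cG by simp
    \<comment> \<open>Skipping the first i - l points leaves exactly the last \<open>l\<close>
      points of \<open>G\<close> in \<open>L\<close>.\<close>
    define c where "c = i - l"
    have "L \<inter> window h G c k = window h G 0 i \<inter> window h G c k"
      using GL window_subset[of h G c k] by blast
    also have "\<dots> = window h G c l"
      using ij l_less_k by (simp add: window_Int_window c_def)
    finally have "card (L \<inter> window h G c k) = l"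
      using card_window[OF Gf(1,2), of c l] ij cG by (simp add: c_def)
    moreover have "c + k \<le> card G"
      using ij m(2) cG l_less_k by (simp add: c_def)
    ultimately have 1: "(L, window h G c k) \<in> adj"
      using LR window_in_islands[OF PG] by (simp add: adj_def)
    \<comment> \<open>The second window ends exactly \<open>l\<close> points into the part of
      \<open>G\<close> in \<open>R\<close>, and starts no later than that part.\<close>
    have e: "c + m + l - d + k = i + m + l" "c + m + l - d \<le> i + m"
      using ij m(2) l_less_k by (auto simp: c_def)
    have "window h G (c + m + l - d) k \<inter> R = window h G (c + m + l - d) k \<inter> window h G (i + m) j"
      using GR window_subset[of h G "c + m + l - d" k] by blast
    also have "\<dots> = window h G (i + m) l"
      unfolding window_Int_window e(1) using ij e(2) by (simp add: max_absorb2)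
    finally have "card (window h G (c + m + l - d) k \<inter> R) = l"
      using card_window[OF Gf(1,2), of "i + m" l] ij cG by simp
    moreover have "c + m + l - d + k \<le> card G"
      using ij cG e by simp
    ultimately have "(window h G (c + m + l - d) k, R) \<in> adj"
      using LR window_in_islands[OF PG] by (simp add: adj_def)
    moreover have "c + m + 2 * l \<le> card G"
      using ij cG by (simp add: c_def)
    ultimately show "\<exists>G c. island P G \<and> c + m + 2 * l \<le> card G \<and>
      (window h Q 0 k, window h G c k) \<in> adj \<and> (window h G (c + m + l - d) k, window h Q (k + N) k) \<in> adj"
      using 1 PG unfolding L_def R_def by blast
  qed
qed

text \<open>With \<open>m\<close> chosen so that m + l = q d, the two windows of \<open>G\<close>
  lie (q - 1) d apart and shifts by \<open>d\<close> connect them. At most four shifts and the two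
  links to the end windows give 6.\<close>

lemma reach_link_short:
  assumes Q: "island P Q" and N: "card Q = 2 * k + N" "2 * d \<le> N" "N \<le> 4 * d"
  shows "reach 6 (window h Q 0 k) (window h Q (k + N) k)"
proof -
  obtain m0 where m0: "2 * m0 \<le> N"
    "\<And>m. m0 \<le> m \<Longrightarrow> d \<le> m + l \<Longrightarrow> m \<le> N \<Longrightarrow> \<exists>G c. island P G \<and> c + m + 2 * l \<le> card G \<and>
      (window h Q 0 k, window h G c k) \<in> adj \<and> (window h G (c + m + l - d) k, window h Q (k + N) k) \<in> adj"
    using halving_cut[OF Q N(1)] by blast
  have d: "0 < d" "l \<le> d"
    using l_less_k two_l_le_k by auto
  define x where "x = max (m0 + l) d"
  \<comment> \<open>The quotient x / d rounded up; rounding costs at most d - 1, which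
    \<open>N\<close> can absorb because \<open>2 * d \<le> N\<close>.\<close>
  define q where "q = (x + d - 1) div d"
  have x: "m0 + l \<le> x" "d \<le> x" "x + d - 1 \<le> N + l"
    using N m0(1) d by (auto simp: x_def)
  have "q * d \<le> x + d - 1"
    unfolding q_def by simp
  moreover have "x + d - 1 < q * d + d"
    unfolding q_def using dividend_less_div_times[OF d(1), of "x + d - 1"] by (simp only: add.commute)
  ultimately have q: "x \<le> q * d" "q * d \<le> N + l"
    using x d by auto
  define m where "m = q * d - l"
  have m: "m + l = q * d"
    unfolding m_def using q x by simp
  have "1 \<le> q"
    using q x d by (cases q) auto
  moreover have "q \<le> 5"
  proof -
    have "q * d \<le> 5 * d"
      using q N d by linarith
    then show ?thesis
      using d(1) by simp
  qed
  moreover obtain G c where G: "island P G" "c + m + 2 * l \<le> card G"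
      "(window h Q 0 k, window h G c k) \<in> adj" "(window h G (c + m + l - d) k, window h Q (k + N) k) \<in> adj"
  proof -
    have "m0 \<le> m" "d \<le> m + l" "m \<le> N"
      using m q x by linarith+
    then show ?thesis
      using m0(2)[of m] that by blast
  qed
  moreover have s: "c + (q - 1) * d = c + m + l - d"
  proof -
    have "d + (q - 1) * d = q * d"
      using \<open>1 \<le> q\<close> by (cases q) simp_all
    then show ?thesis
      using m by linarith
  qed
  ultimately have "reach (q - 1) (window h G c k) (window h G (c + m + l - d) k)"
    using reach_shift[OF G(1), of c "q - 1"] m q x d by simp
  then have "reach (1 + (q - 1) + 1) (window h Q 0 k) (window h Q (k + N) k)"
    using G reach_adj reach_trans by blast
  then show ?thesis
    using \<open>q \<le> 5\<close> by (auto intro: reach_mono)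
qed

text \<open>Each halving costs two adjacencies, one at either end, and leaves a shorter instance of
  the same problem inside a window of \<open>G\<close>.\<close>

lemma reach_link:
  assumes "island P Q" "card Q = 2 * k + N" "2 * d \<le> N" "N \<le> 2 ^ j * (4 * d)"
  shows "reach (2 * j + 6) (window h Q 0 k) (window h Q (k + N) k)"
  using assms
proof (induction j arbitrary: Q N)
  case 0
  then show ?case
    using reach_link_short by simp
next
  case (Suc j)
  show ?case
  proof (cases "N \<le> 4 * d")
    case True
    then show ?thesis
      using reach_link_short[OF Suc.prems(1-3)] by (auto intro: reach_mono)
  next
    case False
    obtain m0 where m0: "2 * m0 \<le> N"
      "\<And>m. m0 \<le> m \<Longrightarrow> d \<le> m + l \<Longrightarrow> m \<le> N \<Longrightarrow> \<exists>G c. island P G \<and> c + m + 2 * l \<le> card G \<and>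
      (window h Q 0 k, window h G c k) \<in> adj \<and> (window h G (c + m + l - d) k, window h Q (k + N) k) \<in> adj"
      using halving_cut[OF Suc.prems(1,2)] by blast
    \<comment> \<open>The trimmed window has m + 2 l = 2 k + (m - 2 d) points, so m at least 4 d
      keeps the new middle count at least 2 d, as the induction hypothesis requires.\<close>
    define m where "m = max m0 (4 * d)"
    have m: "m0 \<le> m" "d \<le> m + l" "m \<le> N" "4 * d \<le> m"
      using False m0(1) by (auto simp: m_def)
    have "1 * (4 * d) \<le> 2 ^ j * (4 * d)"
      by (intro mult_right_mono) auto
    then have mj: "m \<le> 2 ^ j * (4 * d)"
      using Suc.prems(4) m0(1) by (simp add: m_def)
    obtain G c where G: "island P G" "c + m + 2 * l \<le> card G"
      "(window h Q 0 k, window h G c k) \<in> adj" "(window h G (c + m + l - d) k, window h Q (k + N) k) \<in> adj"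
      using m0(2)[OF m(1-3)] by blast
    note Gf = islandD[OF G(1)]
    define Q' where "Q' = window h G c (m + 2 * l)"
    have "card Q' = m + 2 * l"
      unfolding Q'_def using card_window[OF Gf(1,2)] G(2) by simp
    then have N': "card Q' = 2 * k + (m - 2 * d)"
      using m l_less_k by simp
    have "reach (2 * j + 6) (window h Q' 0 k) (window h Q' (k + (m - 2 * d)) k)"
      by (rule Suc.IH) (use island_of_window[OF G(1)] N' m mj in \<open>auto simp: Q'_def\<close>)
    moreover have "window h Q' 0 k = window h G c k"
      unfolding Q'_def using window_window[OF Gf(1,2), of 0 k "m + 2 * l" c] m l_less_k by simp
    moreover have "window h Q' (k + (m - 2 * d)) k = window h G (c + m + l - d) k"
    proof -
      have "c + (k + (m - 2 * d)) = c + m + l - d"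
        using m l_less_k by simp
      then show ?thesis
        unfolding Q'_def using window_window[OF Gf(1,2), of "k + (m - 2 * d)" k "m + 2 * l" c] m l_less_k
        by simp
    qed
    ultimately have "reach (1 + (2 * j + 6) + 1) (window h Q 0 k) (window h Q (k + N) k)"
      using G reach_adj reach_trans by metis
    then show ?thesis by simp
  qed
qed


text \<open>If \<open>p\<close> is large, the given window ends a long prefix of \<open>P\<close>,
  so it is linked to the first window and then to the last one. Otherwise p < k + 2 d, at most 4 d,
  so at most three shifts lead to start p mod d, and enough points remain to its right for a single
  link.\<close>

lemma reach_last_window:
  assumes n: "2 * k + 3 * d \<le> card P" "card P \<le> 2 ^ J" and p: "p + k \<le> card P"
  shows "reach (4 * J + 12) (window h P p k) (window h P (card P - k) k)"
proof -
  have d: "0 < d" "l \<le> d"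
    using l_less_k two_l_le_k by auto
  have link: "reach (2 * J + 6) (window h P a k) (window h P (a + b - k) k)"
    if "a + b \<le> card P" "2 * k + 2 * d \<le> b" for a b
  proof -
    let ?Q = "window h P a b"
    have b: "card ?Q = 2 * k + (b - 2 * k)"
      using card_window[OF fin inj that(1)] that(2) by simp
    have "2 ^ J * 1 \<le> 2 ^ J * (4 * d)"
      using d by (intro mult_left_mono) auto
    then have "b - 2 * k \<le> 2 ^ J * (4 * d)"
      using n(2) that(1) by linarith
    then have "reach (2 * J + 6) (window h ?Q 0 k) (window h ?Q (k + (b - 2 * k)) k)"
      using that by (intro reach_link island_of_window island_self b) auto
    then show ?thesis
      using that(2) by (simp add: window_window[OF fin inj])
  qed
  show ?thesis
  proof (cases "k + 2 * d \<le> p")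
    case True
    have "reach (2 * J + 6) (window h P p k) (window h P 0 k)"
      by (rule reach_sym) (use link[of 0 "p + k"] True p in simp)
    moreover have "reach (2 * J + 6) (window h P 0 k) (window h P (card P - k) k)"
      using link[of 0 "card P"] n by simp
    ultimately have "reach ((2 * J + 6) + (2 * J + 6)) (window h P p k) (window h P (card P - k) k)"
      by (rule reach_trans)
    then show ?thesis
      by (rule reach_mono) simp
  next
    case False
    have "p div d * d < 4 * d"
      using False d div_times_less_eq_dividend[of p d] by linarith
    then have "p div d \<le> 3"
      using d(1) by simp
    moreover have "reach (p div d) (window h P (p mod d) k) (window h P p k)"
      using reach_shift[OF island_self, of "p mod d" "p div d"] p by (simp only: mod_div_mult_eq)
    ultimately have "reach 3 (window h P p k) (window h P (p mod d) k)"
      using reach_sym reach_mono by blast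
    moreover have "p mod d < d"
      using d(1) by simp
    then have "reach (2 * J + 6) (window h P (p mod d) k) (window h P (card P - k) k)"
      using link[of "p mod d" "card P - p mod d"] n by simp
    ultimately have "reach (3 + (2 * J + 6)) (window h P p k) (window h P (card P - k) k)"
      by (rule reach_trans)
    then show ?thesis
      by (rule reach_mono) simp
  qed
qed

section \<open>From an arbitrary island to a window\<close>

lemma ex_sparse_window:
  assumes n: "Suc d * k \<le> card P" and A: "card A = k" "finite A"
  shows "\<exists>p. p + k \<le> card P \<and> card (A \<inter> window h P p k) \<le> l"
proof (rule ccontr)
  assume "\<not> ?thesis"
  then have big: "Suc l \<le> card (A \<inter> window h P p k)" if "p + k \<le> card P" for p
    using that by (meson not_less_eq_eq)
  \<comment> \<open>Disjoint consecutive windows are counted: d + 1 of them would hold at least (d +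
    1)(l + 1) points of \<open>A\<close>, more than d + l = k.\<close>
  have "t * Suc l \<le> card (A \<inter> window h P 0 (t * k))" if "t * k \<le> card P" for t
    using that
  proof (induction t)
    case (Suc t)
    have "card (A \<inter> window h P 0 (Suc t * k))
        = card (A \<inter> window h P 0 (t * k)) + card (A \<inter> window h P (t * k) k)"
      using window_add[OF fin inj, of A 0 "t * k" k] by (simp add: add.commute)
    then show ?case
      using Suc big[of "t * k"] by simp
  qed simp
  then have "Suc d * Suc l \<le> card (A \<inter> window h P 0 (Suc d * k))"
    using n by blast
  also have "\<dots> \<le> k"
    using A card_mono[of A] by (metis inf_le1)
  finally have "Suc d * Suc l \<le> d + l"
    using l_less_k by simp
  then show False
    by simp
qed

text \<open>Sliding a window by one changes its number of points of \<open>A\<close> by at most one,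
  so the value \<open>l\<close> occurs between the given window and a sparse one.\<close>

lemma adj_window:
  assumes n: "Suc d * k \<le> card P" and A: "A \<in> islands P k"
    and p: "p + k \<le> card P" "l \<le> card (A \<inter> window h P p k)"
  obtains q where "q + k \<le> card P" "(A, window h P q k) \<in> adj"
proof -
  define f where "f q = card (A \<inter> window h P q k)" for q
  have cA: "card A = k" "finite A"
    using A by (auto simp: islands_def)
  have step: "f (Suc q) \<le> Suc (f q)" "f q \<le> Suc (f (Suc q))" for q
    using window_add[OF fin inj, of A q k 1] window_add[OF fin inj, of A q 1 k]
      card_Int_window_1[OF fin inj, of A q] card_Int_window_1[OF fin inj, of A "q + k"]
    by (auto simp: f_def)
  obtain q0 where q0: "q0 + k \<le> card P" "f q0 \<le> l"
    using ex_sparse_window[OF n cA] unfolding f_def by blast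
  have "\<exists>q. q + k \<le> card P \<and> f q = l"
  proof (cases "q0 \<le> p")
    case True
    then obtain i where "i \<le> p" "f i = l"
      using nat_intermediate_value[of q0 p f l] q0 p step unfolding f_def by blast
    then show ?thesis
      using p(1) by (intro exI[of _ i]) auto
  next
    case False
    \<comment> \<open>The sparse window lies to the right here, so the index is reversed to run from
      it back to \<open>p\<close>.\<close>
    have "f (p + q0 - Suc i) \<le> Suc (f (p + q0 - i))" if "i < q0" for i
      using step(2)[of "p + q0 - Suc i"] that by (simp add: Suc_diff_Suc)
    then obtain i where "p \<le> i" "i \<le> q0" "f (p + q0 - i) = l"
      using nat_intermediate_value[of p q0 "\<lambda>i. f (p + q0 - i)" l] False q0 p(2)
      by (auto simp: f_def)
    then show ?thesis
      using q0 by (intro exI[of _ "p + q0 - i"]) auto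
  qed
  then obtain q where "q + k \<le> card P" "f q = l"
    by blast
  then show ?thesis
    using that A window_in_islands[OF island_self] by (auto simp: adj_def f_def)
qed

lemma reach_some_window:
  assumes n: "Suc d * k \<le> card P" and "A \<in> islands P k" "A \<subseteq> window h P a b"
    "a + b \<le> card P" "b \<le> 2 ^ j * k"
  shows "\<exists>q. q + k \<le> card P \<and> reach (Suc j) A (window h P q k)"
  using assms(2-)
proof (induction j arbitrary: A a b rule: less_induct)
  case (less j)
  have cA: "card A = k" "finite A" and PA: "island P A"
    using less.prems(1) by (auto simp: islands_def)
  have sub: "\<exists>c\<le>b'. card (A \<inter> window h P a' c) = l" if "l \<le> card (A \<inter> window h P a' b')" for a' b'
  proof -
    have "card (A \<inter> window h P a' (Suc c)) \<le> Suc (card (A \<inter> window h P a' c))" for c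
      using window_add[OF fin inj, of A a' c 1] card_Int_window_1[OF fin inj, of A "a' + c"] by simp
    then show ?thesis
      using nat_intermediate_value[of 0 b' "\<lambda>c. card (A \<inter> window h P a' c)" l] that
      by (auto simp: window_0)
  qed
  have Ab: "card (A \<inter> window h P a b) = k"
    using less.prems(2) cA by (simp add: Int_absorb2)
  \<comment> \<open>Take a prefix of the slab with exactly \<open>l\<close> points of
    \<open>A\<close>. If it is longer than half, the rest is shorter than half and still holds k -
    l, hence at least \<open>l\<close>, points of \<open>A\<close>.\<close>
  obtain a' b' where ab: "a' + b' \<le> card P" "2 * b' \<le> b" "card (A \<inter> window h P a' b') = l"
  proof -
    obtain c where c: "c \<le> b" "card (A \<inter> window h P a c) = l"
      using sub[of a b] Ab l_less_k by auto
    show ?thesis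
    proof (cases "2 * c \<le> b")
      case True
      then show ?thesis
        using that[of a c] c less.prems by simp
    next
      case False
      have "card (A \<inter> window h P (a + c) (b - c)) = k - l"
        using window_add[OF fin inj, of A a c "b - c"] c Ab by simp
      then obtain c' where "c' \<le> b - c" "card (A \<inter> window h P (a + c) c') = l"
        using sub[where a' = "a + c" and b' = "b - c"] two_l_le_k by fastforce
      then show ?thesis
        using that[of "a + c" c'] False c(1) less.prems(3) by simp
    qed
  qed
  show ?case
  proof (cases "b' \<le> k")
    case True
    have kn: "k \<le> card P"
      using PA cA island_subset[OF PA] card_mono[OF fin] by blast
    \<comment> \<open>The window is moved left where necessary so that all \<open>k\<close>
      positions exist.\<close>
    define p where "p = min a' (card P - k)"
    have p: "p + k \<le> card P"
      using kn by (simp add: p_def)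
    have "window h P a' b' \<subseteq> window h P p k"
      using True ab(1) kn by (intro window_mono) (auto simp: p_def)
    then have "l \<le> card (A \<inter> window h P p k)"
      using ab(3) cA card_mono[of "A \<inter> window h P p k" "A \<inter> window h P a' b'"] by blast
    then obtain q where "q + k \<le> card P" "(A, window h P q k) \<in> adj"
      using adj_window[OF n less.prems(1) p] by blast
    then show ?thesis
      using reach_mono[OF reach_adj, of A _ "Suc j"] by auto
  next
    case False
    \<comment> \<open>For j = 0 the slab would have at most k / 2 points, against \<open>b'\<close>
      exceeding \<open>k\<close>.\<close>
    then obtain i where j: "j = Suc i"
      using ab(2) less.prems(4) by (cases j) auto
    define S where "S = window h P a' b'"
    have S: "island P S" "card S = b'" "finite S"
      using island_of_window[OF island_self] card_window[OF fin inj ab(1)] finite_window[OF fin]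
      by (auto simp: S_def)
    obtain C where C: "convex C" "A = P \<inter> C"
      using PA by (auto simp: island_def)
    have "island S (A \<inter> S)"
      unfolding island_def using C island_subset[OF S(1)] by blast
    then obtain B where B: "island S B" "A \<inter> S \<subseteq> B" "card (B \<inter> S) = k"
      using island_grow[OF S(3), of "A \<inter> S" S k] S(2) False ab(3) l_less_k by (auto simp: S_def)
    have BS: "B \<subseteq> S"
      using island_subset B by blast
    have "B \<in> islands P k"
      using island_trans[OF S(1) B(1)] B(3) BS S(3) finite_subset
      by (auto simp: islands_def Int_absorb2)
    \<comment> \<open>Growth stays inside \<open>S\<close>, all of whose points of \<open>A\<close>
      are already present, so no new common point arises.\<close>
    moreover have "A \<inter> B = A \<inter> S"
      using BS B(2) by blast
    ultimately have "(A, B) \<in> adj"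
      using less.prems(1) ab(3) by (simp add: adj_def S_def)
    moreover obtain q where "q + k \<le> card P" "reach (Suc i) B (window h P q k)"
      using less.IH[of i B a' b'] \<open>B \<in> islands P k\<close> BS ab less.prems(4) j by (auto simp: S_def)
    ultimately show ?thesis
      using reach_trans[OF reach_adj] j by fastforce
  qed
qed

lemma reach_islands:
  assumes n: "Suc d * k \<le> card P" "2 * k + 3 * d \<le> card P" "card P \<le> 2 ^ J"
    and I: "I \<in> islands P k" and I': "I' \<in> islands P k"
  shows "reach (10 * J + 26) I I'"
proof -
  have *: "reach (5 * J + 13) A (window h P (card P - k) k)" if "A \<in> islands P k" for A
  proof -
    have "A \<subseteq> window h P 0 (card P)"
      using that island_subset by (auto simp: islands_def window_all[OF fin inj])
    moreover have "card P \<le> 2 ^ J * k"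
      using n(3) l_less_k mult_le_mono2[of 1 k "2 ^ J"] by linarith
    ultimately obtain q where q: "q + k \<le> card P" "reach (Suc J) A (window h P q k)"
      using reach_some_window[OF n(1) \<open>A \<in> islands P k\<close>, of 0 "card P" J] by auto
    show ?thesis
      using reach_trans[OF q(2) reach_last_window[OF n(2,3) q(1)]] by (rule reach_mono) simp
  qed
  show ?thesis
    using reach_trans[OF *[OF I] reach_sym[OF *[OF I']]] by (rule reach_mono) simp
qed

end

section \<open>Generic coordinates and the passage to graph distance\<close>

lemma exists_generic_functional:
  fixes P :: "(real^2) set"
  assumes "finite P"
  obtains c where "inj_on (\<lambda>v. v $ 1 + c * v $ 2) P"
proof -
  \<comment> \<open>These are the values of \<open>c\<close> at which two points could collide.
    Pairs with equal second coordinates contribute 0, the value of division by zero, which merely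
    excludes one more \<open>c\<close>.\<close>
  define B where "B = (\<lambda>(p, q). - (p $ 1 - q $ 1) / (p $ 2 - q $ 2)) ` (P \<times> P)"
  have "finite B"
    using assms by (simp add: B_def)
  then obtain c where c: "c \<notin> B"
    using ex_new_if_finite infinite_UNIV_char_0 by blast
  have "inj_on (\<lambda>v. v $ 1 + c * v $ 2) P"
  proof (rule inj_onI)
    fix p q assume pq: "p \<in> P" "q \<in> P" "p $ 1 + c * p $ 2 = q $ 1 + c * q $ 2"
    then have e: "c * (p $ 2 - q $ 2) = - (p $ 1 - q $ 1)"
      by (simp add: algebra_simps)
    have "p $ 2 = q $ 2"
    proof (rule ccontr)
      assume "p $ 2 \<noteq> q $ 2"
      then have "c = - (p $ 1 - q $ 1) / (p $ 2 - q $ 2)"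
        using e by (simp add: eq_divide_eq)
      then have "c \<in> B"
        using pq by (force simp: B_def)
      then show False
        using c by simp
    qed
    then show "p = q"
      using pq by (simp add: vec_eq_iff forall_2)
  qed
  then show ?thesis
    using that by blast
qed

lemma collinear_level_set:
  fixes a :: "real^2"
  assumes "a \<noteq> 0"
  shows "collinear {v. a \<bullet> v = t}"
  using aff_dim_hyperplane[OF assms, of t] by (simp add: collinear_aff_dim)

lemma graph_dist_le_relpow:
  assumes "finite P" "l < k" "I \<in> islands P k"
    "(I, J) \<in> {(I, J). I \<in> islands P k \<and> J \<in> islands P k \<and> card (I \<inter> J) = l} ^^ m"
  shows "graph_dist (IJ P k l) I J \<le> ereal (real m)"
proof -
  interpret graph "IJ P k l"
    using graph_IJ assms by blast
  let ?E = "{(I, J). I \<in> islands P k \<and> J \<in> islands P k \<and> card (I \<inter> J) = l}"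
  have simps: "verts (IJ P k l) = islands P k" "arcs (IJ P k l) = ?E"
    "tail (IJ P k l) = fst" "head (IJ P k l) = snd"
    by (simp_all add: IJ_def)
  have "\<exists>p. awalk I p J \<and> length p = m"
    using assms(3,4)
  proof (induction m arbitrary: I)
    case 0
    then show ?case
      by (intro exI[of _ "[]"]) (auto simp: awalk_Nil_iff simps)
  next
    case (Suc m)
    obtain K where K: "(I, K) \<in> ?E" "(K, J) \<in> ?E ^^ m"
      using relpow_Suc_D2[OF Suc.prems(2)] by blast
    then obtain p where "awalk K p J" "length p = m"
      using Suc.IH[of K] by auto
    then show ?case
      using K(1) by (intro exI[of _ "(I, K) # p"]) (auto simp: awalk_Cons_iff simps)
  qed
  then obtain p where p: "awalk I p J" "length p = m"
    by blast
  have "graph_dist (IJ P k l) I J \<le> awalk_cost (\<lambda>_. 1) p"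
    unfolding graph_dist_def by (rule min_cost_le_walk_cost[OF p(1)])
  also have "awalk_cost (\<lambda>_. 1 :: real) p = m"
    using p(2) by (simp add: awalk_cost_def sum_list_triv)
  finally show ?thesis .
qed

lemma graph_dist_IJ_le:
  assumes "finite P" "general_position P" "l < k" "2 * l \<le> k"
    and n: "2 * ((k - l) * (k - l + 1) + k) \<le> card P" "card P \<le> 2 ^ J"
    and I: "I \<in> islands P k" and I': "I' \<in> islands P k"
  shows "graph_dist (IJ P k l) I I' \<le> ereal (real (10 * J + 26))"
proof -
  obtain c where c: "inj_on (\<lambda>v. v $ 1 + c * v $ 2) P"
    using exists_generic_functional[OF assms(1)] by blast
  interpret island_graph P k l "\<lambda>v. v $ 1 + c * v $ 2" "\<lambda>v. v $ 2"
  proof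
    show "collinear {v :: real^2. v $ 2 - s * (v $ 1 + c * v $ 2) = t}" for s t
    proof -
      \<comment> \<open>A normal vector of the level line; if its first entry vanishes, then s = 0
        and its second entry is 1.\<close>
      define a :: "real^2" where "a = vector [- s, 1 - s * c]"
      have "a $ 1 \<noteq> 0 \<or> a $ 2 \<noteq> 0"
        by (auto simp: a_def vector_2)
      then have "a \<noteq> 0"
        by auto
      moreover have "a \<bullet> v = v $ 2 - s * (v $ 1 + c * v $ 2)" for v
        by (simp add: a_def inner_vec_def sum_2 vector_2 algebra_simps)
      ultimately show ?thesis
        using collinear_level_set[of a t] by simp
    qed
  qed (use assms c in \<open>auto simp: linear_iff algebra_simps\<close>)
  have k: "k \<le> 2 * d" "1 \<le> d"
    using assms(3,4) by auto
  \<comment> \<open>Since k is at most 2 d, (d + 1) k is at most 2 d^2 + k, within the assumed size.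
    Below, d at most d^2 gives 2 k + 4 d at most 2 (d (d + 1) + k).\<close>
  have "d * k \<le> d * (2 * d)"
    using k(1) by (rule mult_le_mono2)
  then have n1: "Suc d * k \<le> card P"
    using n(1) by (simp add: algebra_simps)
  have "1 * d \<le> d * d"
    using k(2) by (rule mult_le_mono1)
  then have n2: "2 * k + 3 * d \<le> card P"
    using n(1) k(2) by (simp add: algebra_simps)
  obtain m where m: "m \<le> 10 * J + 26" "(I, I') \<in> adj ^^ m"
    using reach_islands[OF n1 n2 n(2) I I'] unfolding reach_def by blast
  have "graph_dist (IJ P k l) I I' \<le> ereal (real m)"
    using m(2) assms(1,3) I unfolding adj_def by (intro graph_dist_le_relpow)
  also have "\<dots> \<le> ereal (real (10 * J + 26))"
    using m(1) by simp
  finally show ?thesis .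
qed

theorem theorem9:
  shows "\<exists>C1 C2 :: real. \<forall>(P :: (real^2) set) (n :: nat) (k :: nat) (l :: nat).
    finite P \<and> card P = n \<and> general_position P \<and> l < k \<and> k \<le> n \<and>
    n \<ge> 2 * ((k - l) * (k - l + 1) + k) \<and> real l \<le> real k / 2 \<longrightarrow>
    graph_diameter (IJ P k l) \<le> ereal (C1 * ln (real n) + C2 * real (k - l))"
\<comment> \<open>With 2^j at most n and n below 2^(j+1), the distance bound is 10 (j + 1) + 26 = 10
  j + 36. Here j is at most ln n / ln 2, and 36 is absorbed because ln n is at least 1. The bound is
  purely logarithmic, so the second constant is 0.\<close>
proof (rule exI[of _ "10 / ln 2 + 36"], rule exI[of _ 0], intro allI impI, elim conjE)
  fix P :: "(real^2) set" and n k l :: nat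
  assume P: "finite P" "card P = n" "general_position P" and kl: "l < k" "k \<le> n"
    and n: "2 * ((k - l) * (k - l + 1) + k) \<le> n" and "real l \<le> real k / 2"
  then have l2: "2 * l \<le> k"
    by linarith
  have "1 * 2 \<le> (k - l) * (k - l + 1)"
    using kl by (intro mult_le_mono) auto
  then have "2 * (1 * 2 + k) \<le> n"
    by (intro order_trans[OF _ n] mult_le_mono2 add_le_mono1)
  then have n3: "3 \<le> n"
    by simp
  obtain j where j: "2 ^ j \<le> n" "n < 2 ^ (j + 1)"
    using ex_power_ivl1[of 2 n] n3 by auto
  have "real j * ln 2 = ln (2 ^ j)"
    by (simp add: ln_realpow)
  also have "\<dots> \<le> ln (real n)"
    using j(1) n3 by (simp add: numeral_power_le_of_nat_cancel_iff)
  finally have jn: "real j \<le> ln (real n) / ln 2"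
    by (simp add: pos_le_divide_eq)
  have "exp 1 \<le> real n"
    using exp_le n3 by linarith
  then have ln1: "1 \<le> ln (real n)"
    using n3 by (simp add: ln_ge_iff)
  have "real (10 * (j + 1) + 26) \<le> (10 / ln 2 + 36) * ln (real n)"
  proof -
    have "real (10 * (j + 1) + 26) \<le> 10 * (ln (real n) / ln 2) + 36 * ln (real n)"
      using jn ln1 by simp
    then show ?thesis
      by (simp add: algebra_simps)
  qed
  then have "graph_dist (IJ P k l) I I' \<le> ereal ((10 / ln 2 + 36) * ln (real n) + 0 * real (k - l))"
    if "I \<in> islands P k" "I' \<in> islands P k" for I I'
    using order_trans[OF graph_dist_IJ_le[OF P(1,3) kl(1) l2, of "j + 1" I I']] n P(2) j(2) that
    by (simp add: less_imp_le)
  then show "graph_diameter (IJ P k l) \<le> ereal ((10 / ln 2 + 36) * ln (real n) + 0 * real (k - l))"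
    unfolding graph_diameter_def by (intro SUP_least) (auto simp: IJ_def)
qed

end
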